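(* Let $p$ be a prime, $e\ge 1$ an integer, $g$ an integer that is a unit modulo $p$, and $m$ the multiplicative order of $g$ modulo $p$. Let $f(x,c) = g^{x-1+c}-x \pmod{p^e}$ for $x,c\in\mathbb{Z}$. Then $f(x,c) = f(x, c+m\cdot p^{e-1})$ for all $x, c\in\mathbb{Z}$.
   Context: The function $f:\mathbb{Z}\times\mathbb{Z}\to\mathbb{Z}/p^e\mathbb{Z}$ is defined with $g$ fixed; powers of $g$ with negative exponents are understood in the unit group $(\mathbb{Z}/p^e\mathbb{Z})^\times$. *)

theory Defs
  imports "HOL-Number_Theory.Residues"
begin

text \<open>
  The exponent \<open>x - 1 + c\<close> is an integer and may be negative, so the power is the integer
  power of the group of units; the subtraction is that of the ring of residues modulo \<open>p ^ e\<close>.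
\<close>

definition pow_diff :: "nat \<Rightarrow> nat \<Rightarrow> int \<Rightarrow> int \<Rightarrow> int \<Rightarrow> int" where
  "pow_diff p e g x c =
     (let q = int p ^ e; R = residue_ring q
      in ((g mod q) [^]\<^bsub>units_of R\<^esub> (x - 1 + c)) \<ominus>\<^bsub>R\<^esub> (x mod q))"

end

theory Submission
  imports Defs
begin

text \<open>
  It suffices that \<open>g\<close> to the power \<open>m * p ^ (e - 1)\<close> is \<open>1\<close> modulo \<open>p ^ e\<close>. By the choice of \<open>m\<close>,
  \<open>g ^ m\<close> is \<open>1\<close> modulo \<open>p\<close>, and raising a congruence modulo \<open>p ^ k\<close> to the \<open>p\<close>-th power lifts it
  to one modulo \<open>p ^ (k + 1)\<close>.
\<close>

text \<open>
  Modulo \<open>n\<close>, each of the \<open>n\<close> terms of the cofactor of \<open>a - b\<close> in \<open>a ^ n - b ^ n\<close> is \<open>b ^ (n - 1)\<close>.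
\<close>

lemma cong_power_lift:
  fixes a b q :: int and n :: nat
  assumes cong: "[a = b] (mod q)" and dvd: "int n dvd q"
  shows "[a ^ n = b ^ n] (mod q * int n)"
proof (cases n)
  case 0
  then show ?thesis by simp
next
  case (Suc k)
  have ab: "[a = b] (mod int n)"
    using cong dvd by (rule cong_dvd_modulus)
  have "[(\<Sum>i<Suc k. a ^ i * b ^ (k - i)) = (\<Sum>i<Suc k. b ^ i * b ^ (k - i))] (mod int n)"
    by (intro cong_sum cong_mult cong_pow ab cong_refl)
  also have "(\<Sum>i<Suc k. b ^ i * b ^ (k - i)) = (\<Sum>i<Suc k. b ^ k)"
    by (intro sum.cong) (simp_all flip: power_add)
  also have "\<dots> = int n * b ^ k"
    by (simp add: Suc)
  finally have "int n dvd (\<Sum>i<Suc k. a ^ i * b ^ (k - i))"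
    using cong_dvd_iff by fastforce
  moreover have "q dvd a - b"
    using cong by (simp add: cong_iff_dvd_diff)
  ultimately have "q * int n dvd (a - b) * (\<Sum>i<Suc k. a ^ i * b ^ (k - i))"
    by (simp only: mult_dvd_mono)
  also have "\<dots> = a ^ n - b ^ n"
    by (simp only: Suc diff_power_eq_sum)
  finally show ?thesis
    by (simp only: cong_iff_dvd_diff)
qed

text \<open>Induction on \<open>k\<close>: the modulus is always a positive power of
  \<open>p\<close>, hence divisible by \<open>p\<close>, so \<open>cong_power_lift\<close> applies
  with \<open>n = p\<close> and gains one more factor \<open>p\<close>.\<close>

lemma cong_power_prime_power:
  fixes a b :: int and p k :: nat
  assumes "[a = b] (mod int p)"
  shows "[a ^ p ^ k = b ^ p ^ k] (mod int p ^ Suc k)"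
proof (induction k)
  case 0
  then show ?case using assms by simp
next
  case (Suc k)
  have "[(a ^ p ^ k) ^ p = (b ^ p ^ k) ^ p] (mod int p ^ Suc k * int p)"
    by (rule cong_power_lift[OF Suc.IH]) simp
  then show ?case
    by (simp add: power_mult[symmetric] mult.commute)
qed

text \<open>Lets integer congruences decide equations in the unit group: coprimality puts the
  residue among the units, where group powers are ring powers, that is, integer powers reduced
  modulo \<open>m\<close>.\<close>

lemma (in residues) units_of_pow_mod:
  assumes "coprime a m"
  shows "(a mod m) [^]\<^bsub>units_of R\<^esub> (n :: nat) = a ^ n mod m"
  by (metis assms m_gt_one mod_in_res_units pow_cong units_of_pow)

lemma (in residues) mod_in_Units_iff: "a mod m \<in> Units R \<longleftrightarrow> coprime a m"
  using m_gt_one mod_in_res_units by (auto simp: res_units_eq coprime_mod_left_iff)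

theorem theorem1:
  fixes p e m :: nat and g x c :: int
  assumes "prime p"
    and "e \<ge> 1"
    and "g mod int p \<in> Units (residue_ring (int p))"
    and "m = group.ord (units_of (residue_ring (int p))) (g mod int p)"
  shows "pow_diff p e g x c = pow_diff p e g x (c + int m * int p ^ (e - 1))"
proof -
  have p: "1 < int p"
    using prime_gt_1_nat[OF assms(1)] by simp
  define q where "q = int p ^ e"
  have q: "1 < q"
    unfolding q_def using p assms(2) by (intro one_less_power) auto
  interpret P: residues "int p" "residue_ring (int p)"
    using p by unfold_locales
  interpret Q: residues q "residue_ring q"
    using q by unfold_locales
  interpret UP: group "units_of (residue_ring (int p))"
    by (rule P.units_group)
  interpret UQ: group "units_of (residue_ring q)"
    by (rule Q.units_group)
  have gp: "coprime g (int p)"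
    using assms(3) by (simp only: P.mod_in_Units_iff)
  then have gq: "coprime g q"
    by (simp add: q_def)
  have carr: "g mod q \<in> carrier (units_of (residue_ring q))"
    using gq by (simp add: Q.mod_in_Units_iff units_of_carrier)
  have "(g mod int p) [^]\<^bsub>units_of (residue_ring (int p))\<^esub> m = 1"
    using UP.pow_ord_eq_1[of "g mod int p"] assms(3,4)
    by (simp add: units_of_carrier units_of_one P.res_one_eq)
  then have "[g ^ m = 1] (mod int p)"
    using p by (simp add: P.units_of_pow_mod[OF gp] cong_def)
  \<comment> \<open>Since \<open>e \<ge> 1\<close>, \<open>Suc (e - 1)\<close> is \<open>e\<close>,
    so the modulus obtained is exactly \<open>q\<close>.\<close>
  from cong_power_prime_power[OF this, of "e - 1"]
  have "[g ^ (m * p ^ (e - 1)) = 1] (mod q)"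
    using assms(2) by (simp add: power_mult q_def flip: power_Suc)
  then have "(g mod q) [^]\<^bsub>units_of (residue_ring q)\<^esub> (m * p ^ (e - 1)) = \<one>\<^bsub>units_of (residue_ring q)\<^esub>"
    using q by (simp add: Q.units_of_pow_mod[OF gq] units_of_one Q.res_one_eq cong_def)
  \<comment> \<open>The exponent becomes an integer, because it is to be split off from a sum with
    \<open>x - 1 + c\<close>, which may be negative.\<close>
  then have one: "(g mod q) [^]\<^bsub>units_of (residue_ring q)\<^esub> (int m * int p ^ (e - 1))
      = \<one>\<^bsub>units_of (residue_ring q)\<^esub>"
    by (simp flip: int_pow_int)
  have "(g mod q) [^]\<^bsub>units_of (residue_ring q)\<^esub> (x - 1 + (c + int m * int p ^ (e - 1)))
      = (g mod q) [^]\<^bsub>units_of (residue_ring q)\<^esub> (x - 1 + c)"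
    using UQ.int_pow_mult[OF carr, of "x - 1 + c" "int m * int p ^ (e - 1)"] one
      UQ.int_pow_closed[OF carr]
    by (simp add: add.assoc)
  then show ?thesis
    by (simp add: pow_diff_def Let_def q_def)
qed

end
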